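(* The group $\mathbb Z_n^3$ has a $3$-fold (unmixed) Beauville structure if and only if $\gcd(n,6)=1$.
   Context: $\mathbb Z_n=\mathbb Z/n\mathbb Z$ is the cyclic group of order $n$. For a finite group $H$, a generating triple is a triple $S=[a,b,c]$ of non-trivial elements of $H$ with $H=\langle a,b,c\rangle$ and $a\cdot b\cdot c=1_H$. It is hyperbolic if $\frac1{\mathrm{ord}(a)}+\frac1{\mathrm{ord}(b)}+\frac1{\mathrm{ord}(c)}<1$. The stabilizer set of $S$ is $\Sigma_S=\bigcup_{h\in H}\big(h\langle a\rangle h^{-1}\cup h\langle b\rangle h^{-1}\cup h\langle c\rangle h^{-1}\big)$. A $3$-fold unmixed Beauville structure of a finite group $G$ is a triple $[S_1,S_2,S_3]$ together with normal subgroups $K_1,K_2,K_3\trianglelefteq G$ such that (1) $S_i$ is a hyperbolic generating triple of $G/K_i$ for $i=1,2,3$; (2) $K_1\cap K_2=K_1\cap K_3=K_2\cap K_3=\{1_G\}$; (3) $\bigcap_{i=1}^3\Sigma_{S_i}\cdot K_i=\{1_G\}$, where $\Sigma_{S_i}\cdot K_i\subset G$ is the preimage of $\Sigma_{S_i}\subset G/K_i$ under $G\to G/K_i$.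
   Formalization: The statement is for n ≥ 2; for n = 1 the claim fails literally, since gcd(1,6) = 1 but the trivial group has no non-trivial elements and hence no generating triple. *)

theory Defs
  imports "HOL-Algebra.Algebra"
begin

definition generating_triple :: "('a, 'b) monoid_scheme \<Rightarrow> 'a \<times> 'a \<times> 'a \<Rightarrow> bool" where
  "generating_triple H = (\<lambda>(a, b, c).
     group H \<and> finite (carrier H) \<and>
     {a, b, c} \<subseteq> carrier H - {\<one>\<^bsub>H\<^esub>} \<and>
     generate H {a, b, c} = carrier H \<and>
     a \<otimes>\<^bsub>H\<^esub> b \<otimes>\<^bsub>H\<^esub> c = \<one>\<^bsub>H\<^esub>)"

definition hyperbolic :: "('a, 'b) monoid_scheme \<Rightarrow> 'a \<times> 'a \<times> 'a \<Rightarrow> bool" where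
  "hyperbolic H = (\<lambda>(a, b, c).
     1 / real (group.ord H a) + 1 / real (group.ord H b) + 1 / real (group.ord H c) < 1)"

definition stabilizer_set :: "('a, 'b) monoid_scheme \<Rightarrow> 'a \<times> 'a \<times> 'a \<Rightarrow> 'a set" where
  "stabilizer_set H = (\<lambda>(a, b, c).
     \<Union>h\<in>carrier H. \<Union>x\<in>{a, b, c}. (h <#\<^bsub>H\<^esub> generate H {x}) #>\<^bsub>H\<^esub> inv\<^bsub>H\<^esub> h)"

(* The preimage under the projection G \<rightarrow> G Mod K, g \<mapsto> K #> g, of a set of cosets of K. *)
definition quotient_preimage :: "('a, 'b) monoid_scheme \<Rightarrow> 'a set \<Rightarrow> 'a set set \<Rightarrow> 'a set" where
  "quotient_preimage G K A = {g \<in> carrier G. K #>\<^bsub>G\<^esub> g \<in> A}"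

(* S and K are families indexed by 1, 2, 3; their values at other indices are irrelevant. *)
definition beauville_structure3 ::
  "('a, 'b) monoid_scheme \<Rightarrow> (nat \<Rightarrow> 'a set \<times> 'a set \<times> 'a set) \<Rightarrow> (nat \<Rightarrow> 'a set) \<Rightarrow> bool" where
  "beauville_structure3 G S K \<longleftrightarrow>
     group G \<and> finite (carrier G) \<and>
     (\<forall>i\<in>{1, 2, 3}. K i \<lhd> G) \<and>
     (\<forall>i\<in>{1, 2, 3}. generating_triple (G Mod K i) (S i) \<and> hyperbolic (G Mod K i) (S i)) \<and>
     K 1 \<inter> K 2 = {\<one>\<^bsub>G\<^esub>} \<and> K 1 \<inter> K 3 = {\<one>\<^bsub>G\<^esub>} \<and> K 2 \<inter> K 3 = {\<one>\<^bsub>G\<^esub>} \<and>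
     (\<Inter>i\<in>{1, 2, 3}. quotient_preimage G (K i) (stabilizer_set (G Mod K i) (S i))) = {\<one>\<^bsub>G\<^esub>}"

definition has_beauville_structure3 :: "('a, 'b) monoid_scheme \<Rightarrow> bool" where
  "has_beauville_structure3 G \<longleftrightarrow> (\<exists>S K. beauville_structure3 G S K)"

end

theory Submission
  imports Defs
begin

text \<open>
  In an abelian group conjugation does nothing, so the stabilizer set of \<open>[a, b, c]\<close> is the union
  \<open>\<langle>a\<rangle> \<union> \<langle>b\<rangle> \<union> \<langle>c\<rangle>\<close>, and the question is whether the three unions
  \<open>\<langle>a\<^sub>i\<rangle>K\<^sub>i \<union> \<langle>b\<^sub>i\<rangle>K\<^sub>i \<union> \<langle>c\<^sub>i\<rangle>K\<^sub>i\<close> of subgroups of \<open>G\<close> can meet only in the identity.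

  \<^bold>\<open>The divisors 2 and 3 are obstructions.\<close>
  Let \<open>G\<close> be abelian of exponent dividing \<open>p m\<close> with \<open>p \<in> {2, 3}\<close>, and consider the elements \<open>g\<^sup>m\<close>,
  whose \<open>p\<close>-th power is trivial.
  Modulo \<open>K\<^sub>i\<close> such an element is \<open>\<alpha>\<^sup>s\<beta>\<^sup>t\<close> with \<open>\<alpha> = a\<^sup>m\<close>, \<open>\<beta> = b\<^sup>m\<close> and \<open>0 \<le> s, t < p\<close>; it lies in the
  stabilizer set if \<open>s = 0\<close>, if \<open>t = 0\<close>, or if \<open>s = t\<close>, since \<open>\<alpha>\<beta> = c\<^bsup>-m\<^esup>\<close>.
  For \<open>p = 2\<close> there are no other exponents, so every \<open>g\<^sup>m\<close> lies in all three preimages and must be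
  trivial (\<open>beauville_structure3_exponent_even\<close>).
  For \<open>p = 3\<close> at most two of the nine products are missed, so each of the three preimages misses
  \<open>g\<^sup>m\<close> for at most \<open>2/9\<close> of all \<open>g \<in> G\<close>.
  Hence \<open>g\<^sup>m\<close> is trivial for at least a third of all \<open>g\<close>, and there are at most three elements \<open>g\<^sup>m\<close>
  (\<open>beauville_structure3_exponent_triple\<close>). In \<open>\<int>\<^sub>n\<^sup>3\<close> there are more.

  \<^bold>\<open>The structure for coprime n.\<close>
  With coordinates \<open>x, y, z\<close> on \<open>\<int>\<^sub>n\<^sup>3\<close> let \<open>K\<^sub>1, K\<^sub>2, K\<^sub>3\<close> be the coordinate axes, and choose triples in the
  coordinate planes \<open>(y, z)\<close>, \<open>(z, x)\<close>, \<open>(x, y)\<close> whose three cyclic groups lie on the lines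
  \<open>y \<in> {0, z, -z}\<close>, \<open>z \<in> {0, x, -x}\<close>, \<open>x \<in> {0, 2y, -2y}\<close>
  (\<open>basis3_slope_triple\<close>).
  A common point satisfies \<open>x = 2\<delta>x\<close> with \<open>\<delta> \<in> {-1, 0, 1}\<close>; as \<open>1 - 2\<delta>\<close> is \<open>3\<close>, \<open>1\<close> or \<open>-1\<close>, hence a
  unit modulo \<open>n\<close>, it is the origin (\<open>basis3_has_beauville_structure3\<close>).
\<close>

section \<open>Generating triples of abelian groups\<close>

lemma (in comm_group) stabilizer_set_comm:
  assumes "a \<in> carrier G" "b \<in> carrier G" "c \<in> carrier G"
  shows "stabilizer_set G (a, b, c) = {x [^] s |x s. x \<in> {a, b, c} \<and> s \<in> (UNIV :: int set)}"
proof -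
  have conj: "(h <# generate G {x}) #> inv h = generate G {x}"
    if "h \<in> carrier G" "x \<in> carrier G" for h x
  proof -
    have sub: "generate G {x} \<subseteq> carrier G"
      using generate_in_carrier[of "{x}"] that by auto
    have "h \<otimes> y \<otimes> inv h = y" if "y \<in> generate G {x}" for y
      using that sub \<open>h \<in> carrier G\<close> by (metis inv_closed inv_solve_right m_closed m_comm subsetD)
    then show ?thesis
      unfolding l_coset_def r_coset_def by auto
  qed
  have "stabilizer_set G (a, b, c) = (\<Union>x\<in>{a, b, c}. generate G {x})"
    unfolding stabilizer_set_def using assms conj by auto
  then show ?thesis
    using assms by (auto simp: generate_pow)
qed

text \<open>The third generator is redundant because \<open>c = (ab)\<^bsup>-1\<^esup>\<close>.\<close>
lemma (in comm_group) generating_triple_products: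
  assumes "generating_triple G (a, b, c)" "h \<in> carrier G"
  obtains s t :: int where "h = a [^] s \<otimes> b [^] t"
proof -
  let ?L = "{a [^] s \<otimes> b [^] t |s t. s \<in> (UNIV :: int set) \<and> t \<in> (UNIV :: int set)}"
  from assms have abc: "a \<in> carrier G" "b \<in> carrier G" "c \<in> carrier G" "a \<otimes> b \<otimes> c = \<one>"
    and gen: "generate G {a, b, c} = carrier G"
    by (auto simp: generating_triple_def)
  have "subgroup ?L G"
  proof (rule subgroupI)
    show "inv x \<in> ?L" if x: "x \<in> ?L" for x
    proof -
      obtain s t :: int where "x = a [^] s \<otimes> b [^] t" using x by auto
      then have "inv x = a [^] (- s) \<otimes> b [^] (- t)"
        using abc by (simp add: int_pow_neg inv_mult)
      then show ?thesis by blast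
    qed
    show "x \<otimes> y \<in> ?L" if xy: "x \<in> ?L" "y \<in> ?L" for x y
    proof -
      obtain s t s' t' :: int where "x = a [^] s \<otimes> b [^] t" "y = a [^] s' \<otimes> b [^] t'"
        using xy by blast
      then have "x \<otimes> y = a [^] (s + s') \<otimes> b [^] (t + t')"
        using abc by (simp add: int_pow_mult m_ac)
      then show ?thesis by blast
    qed
  qed (use abc in auto)
  moreover have "{a, b, c} \<subseteq> ?L"
  proof -
    have "a = a [^] (1::int) \<otimes> b [^] (0::int)" "b = a [^] (0::int) \<otimes> b [^] (1::int)"
      using abc by simp_all
    moreover have "c = a [^] (-1::int) \<otimes> b [^] (-1::int)"
    proof -
      have "c = inv (a \<otimes> b)"
        using abc by (metis inv_equality m_closed m_comm)
      then show ?thesis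
        using abc by (simp add: int_pow_neg inv_mult)
    qed
    ultimately show ?thesis by blast
  qed
  ultimately have "generate G {a, b, c} \<subseteq> ?L"
    using generate_subgroup_incl by blast
  then show thesis
    using gen assms(2) that by blast
qed

lemma (in group) int_pow_mod:
  assumes "x \<in> carrier G" "x [^] (k :: nat) = \<one>"
  shows "x [^] (s :: int) = x [^] (s mod int k)"
proof -
  have "x [^] s = x [^] (int k * (s div int k) + s mod int k)" by simp
  also have "\<dots> = (x [^] int k) [^] (s div int k) \<otimes> x [^] (s mod int k)"
    using assms(1) by (simp only: int_pow_mult int_pow_pow)
  finally show ?thesis using assms by (simp add: int_pow_int)
qed

lemma (in comm_group) power_products:
  fixes m :: nat
  assumes "generating_triple G (a, b, c)" "h \<in> carrier G"
    and "\<And>x. x \<in> carrier G \<Longrightarrow> x [^] (p * m) = \<one>"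
  obtains s t :: int where "h [^] m = (a [^] m) [^] (s mod int p) \<otimes> (b [^] m) [^] (t mod int p)"
proof -
  have abc: "a \<in> carrier G" "b \<in> carrier G"
    using assms(1) by (auto simp: generating_triple_def)
  have "(x [^] m) [^] p = \<one>" if "x \<in> carrier G" for x
    using assms(3)[OF that] that by (simp add: nat_pow_pow mult.commute)
  moreover obtain s t :: int where "h = a [^] s \<otimes> b [^] t"
    using generating_triple_products[OF assms(1,2)] .
  then have "h [^] m = (a [^] m) [^] s \<otimes> (b [^] m) [^] t"
    using abc by (simp add: int_pow_distrib int_pow_pow mult.commute flip: int_pow_int)
  ultimately have "h [^] m = (a [^] m) [^] (s mod int p) \<otimes> (b [^] m) [^] (t mod int p)"
    using abc by (metis int_pow_mod nat_pow_closed)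
  then show thesis using that by blast
qed

text \<open>The three lines through the origin that the stabilizer set covers: the diagonal one comes from
  \<open>ab = c\<^bsup>-1\<^esup>\<close>.\<close>
lemma (in comm_group) powers_in_stabilizer_set:
  fixes m :: nat and s :: int
  assumes "generating_triple G (a, b, c)"
  shows "(a [^] m) [^] s \<in> stabilizer_set G (a, b, c)"
    and "(b [^] m) [^] s \<in> stabilizer_set G (a, b, c)"
    and "(a [^] m) [^] s \<otimes> (b [^] m) [^] s \<in> stabilizer_set G (a, b, c)"
proof -
  from assms have abc: "a \<in> carrier G" "b \<in> carrier G" "c \<in> carrier G" "a \<otimes> b \<otimes> c = \<one>"
    by (auto simp: generating_triple_def)
  note stab = stabilizer_set_comm[OF abc(1-3)]
  show "(a [^] m) [^] s \<in> stabilizer_set G (a, b, c)" "(b [^] m) [^] s \<in> stabilizer_set G (a, b, c)"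
    unfolding stab using abc by (auto simp: int_pow_pow simp flip: int_pow_int)
  have "a \<otimes> b = inv c"
    using abc by (metis inv_equality m_closed)
  then have "(a [^] m) [^] s \<otimes> (b [^] m) [^] s = (inv c) [^] (int m * s)"
    using abc by (simp add: int_pow_pow flip: int_pow_int int_pow_distrib)
  also have "\<dots> = c [^] (- (int m * s))"
    using abc by (simp add: int_pow_neg int_pow_inv)
  finally show "(a [^] m) [^] s \<otimes> (b [^] m) [^] s \<in> stabilizer_set G (a, b, c)"
    unfolding stab by auto
qed

section \<open>Exponents divisible by 2 or 3\<close>

text \<open>The plane over the field with two elements has only three lines through the origin, and the
  stabilizer set covers all of them.\<close>
lemma (in comm_group) involutions_in_stabilizer_set:
  fixes m :: nat
  assumes S: "generating_triple G (a, b, c)" and h: "h \<in> carrier G"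
    and exp: "\<And>x. x \<in> carrier G \<Longrightarrow> x [^] (2 * m) = \<one>"
  shows "h [^] m \<in> stabilizer_set G (a, b, c)"
proof -
  have abc: "a \<in> carrier G" "b \<in> carrier G"
    using S by (auto simp: generating_triple_def)
  obtain s t :: int where st: "h [^] m = (a [^] m) [^] (s mod 2) \<otimes> (b [^] m) [^] (t mod 2)"
    using power_products[OF S h exp] by auto
  have "s mod 2 = 0 \<or> t mod 2 = 0 \<or> s mod 2 = t mod 2" by presburger
  then consider "s mod 2 = 0" | "t mod 2 = 0" | "s mod 2 = t mod 2" by blast
  then show ?thesis
  proof cases
    case 1
    then show ?thesis
      using powers_in_stabilizer_set(2)[OF S, of m "t mod 2"] abc by (simp add: st)
  next
    case 2
    then show ?thesis
      using powers_in_stabilizer_set(1)[OF S, of m "s mod 2"] abc by (simp add: st)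
  next
    case 3
    then show ?thesis
      using powers_in_stabilizer_set(3)[OF S, of m "t mod 2"] by (simp add: st)
  qed
qed

text \<open>Of the four lines through the origin in the plane over the field with three elements, the
  stabilizer set covers three, so with \<open>\<alpha> = a\<^sup>m\<close> and \<open>\<beta> = b\<^sup>m\<close> only \<open>\<alpha>\<beta>\<^sup>2\<close> and \<open>\<alpha>\<^sup>2\<beta>\<close> can be missed. If \<open>\<alpha>\<close> and \<open>\<beta>\<close> were dependent, these
  would be powers of \<open>\<alpha>\<close> or of \<open>\<beta>\<close> and nothing would be missed; so either nothing is missed or there
  are nine products.\<close>
lemma (in comm_group) few_cubic_powers_outside_stabilizer_set:
  fixes m :: nat
  assumes fin: "finite (carrier G)" and S: "generating_triple G (a, b, c)"
    and exp: "\<And>x. x \<in> carrier G \<Longrightarrow> x [^] (3 * m) = \<one>"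
  defines "P \<equiv> (\<lambda>x. x [^] m) ` carrier G"
  shows "9 * card (P - stabilizer_set G (a, b, c)) \<le> 2 * card P"
proof (cases "P \<subseteq> stabilizer_set G (a, b, c)")
  case True
  then have "P - stabilizer_set G (a, b, c) = {}" by blast
  then show ?thesis by (simp only: card.empty)
next
  case False
  let ?\<Sigma> = "stabilizer_set G (a, b, c)"
  define \<alpha> \<beta> where "\<alpha> = a [^] m" and "\<beta> = b [^] m"
  have abc: "a \<in> carrier G" "b \<in> carrier G"
    using S by (auto simp: generating_triple_def)
  have cl [simp]: "\<alpha> \<in> carrier G" "\<beta> \<in> carrier G"
    using abc by (simp_all add: \<alpha>_def \<beta>_def)
  have ord: "\<alpha> [^] (3::nat) = \<one>" "\<beta> [^] (3::nat) = \<one>"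
    using abc exp by (simp_all add: \<alpha>_def \<beta>_def nat_pow_pow mult.commute)
  have outside: "P - ?\<Sigma> \<subseteq> {\<alpha> [^] (1::int) \<otimes> \<beta> [^] (2::int), \<alpha> [^] (2::int) \<otimes> \<beta> [^] (1::int)}"
  proof
    fix x assume x: "x \<in> P - ?\<Sigma>"
    then obtain h where "h \<in> carrier G" "x = h [^] m" by (auto simp: P_def)
    then obtain s t :: int where st: "x = \<alpha> [^] (s mod 3) \<otimes> \<beta> [^] (t mod 3)"
      using power_products[OF S _ exp] unfolding \<alpha>_def \<beta>_def by (metis of_nat_numeral)
    have "s mod 3 \<noteq> 0"
    proof
      assume "s mod 3 = 0"
      then have "x = \<beta> [^] (t mod 3)" using st by simp
      then show False
        using x powers_in_stabilizer_set(2)[OF S, of m] unfolding \<beta>_def by blast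
    qed
    moreover have "t mod 3 \<noteq> 0"
    proof
      assume "t mod 3 = 0"
      then have "x = \<alpha> [^] (s mod 3)" using st by simp
      then show False
        using x powers_in_stabilizer_set(1)[OF S, of m] unfolding \<alpha>_def by blast
    qed
    moreover have "s mod 3 \<noteq> t mod 3"
      using x st powers_in_stabilizer_set(3)[OF S, of m "t mod 3"] unfolding \<alpha>_def \<beta>_def by auto
    ultimately have "s mod 3 = 1 \<and> t mod 3 = 2 \<or> s mod 3 = 2 \<and> t mod 3 = 1" by presburger
    then show "x \<in> {\<alpha> [^] (1::int) \<otimes> \<beta> [^] (2::int), \<alpha> [^] (2::int) \<otimes> \<beta> [^] (1::int)}"
      using st by auto
  qed
  have \<alpha>_indep: "\<alpha> \<noteq> \<beta> [^] j" for j :: int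
  proof
    assume "\<alpha> = \<beta> [^] j"
    then have *: "\<alpha> [^] k \<otimes> \<beta> [^] l = \<beta> [^] (j * k + l)" for k l :: int
      by (simp add: int_pow_pow int_pow_mult)
    show False
      using outside[unfolded *] False powers_in_stabilizer_set(2)[OF S, of m] unfolding \<beta>_def by blast
  qed
  have \<beta>_indep: "\<beta> \<noteq> \<alpha> [^] j" for j :: int
  proof
    assume "\<beta> = \<alpha> [^] j"
    then have *: "\<alpha> [^] k \<otimes> \<beta> [^] l = \<alpha> [^] (k + j * l)" for k l :: int
      by (simp add: int_pow_pow int_pow_mult)
    show False
      using outside[unfolded *] False powers_in_stabilizer_set(1)[OF S, of m] unfolding \<alpha>_def by blast
  qed
  have indep: "3 dvd u \<and> 3 dvd v" if "\<alpha> [^] u \<otimes> \<beta> [^] v = \<one>" for u v :: int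
  proof -
    have eq: "\<alpha> [^] u = \<beta> [^] (- v)" "\<beta> [^] v = \<alpha> [^] (- u)"
      using that by (simp_all add: int_pow_neg inv_equality m_comm inv_equality[symmetric])
    \<comment> \<open>An integer prime to \<open>3\<close> is its own inverse modulo \<open>3\<close>; so a nontrivial relation can be solved for \<open>\<alpha>\<close> or \<open>\<beta>\<close>.\<close>
    have sq: "(w * w) mod 3 = 1" if "\<not> 3 dvd w" for w :: int
    proof -
      have "w mod 3 = 1 \<or> w mod 3 = 2" using that by presburger
      then have "((w mod 3) * (w mod 3)) mod 3 = 1" by auto
      then show ?thesis by (simp add: mod_mult_eq)
    qed
    have "3 dvd u"
    proof (rule ccontr)
      assume "\<not> 3 dvd u"
      then have "\<alpha> = \<alpha> [^] (u * u)"
        using int_pow_mod[OF cl(1) ord(1), of "u * u"] sq by simp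
      also have "\<dots> = \<beta> [^] (- v * u)"
        using eq(1) by (metis int_pow_pow cl)
      finally show False using \<alpha>_indep by blast
    qed
    moreover have "3 dvd v"
    proof (rule ccontr)
      assume "\<not> 3 dvd v"
      then have "\<beta> = \<beta> [^] (v * v)"
        using int_pow_mod[OF cl(2) ord(2), of "v * v"] sq by simp
      also have "\<dots> = \<alpha> [^] (- u * v)"
        using eq(2) by (metis int_pow_pow cl)
      finally show False using \<beta>_indep by blast
    qed
    ultimately show ?thesis ..
  qed
  let ?f = "\<lambda>(s :: int, t :: int). \<alpha> [^] s \<otimes> \<beta> [^] t"
  have "inj_on ?f ({0..2} \<times> {0..2})"
  proof (rule inj_onI, clarify)
    fix s t s' t' :: int
    assume r: "s \<in> {0..2}" "t \<in> {0..2}" "s' \<in> {0..2}" "t' \<in> {0..2}"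
      and e: "\<alpha> [^] s \<otimes> \<beta> [^] t = \<alpha> [^] s' \<otimes> \<beta> [^] t'"
    have "\<alpha> [^] (s - s') \<otimes> \<beta> [^] (t - t') = (\<alpha> [^] s \<otimes> \<beta> [^] t) \<otimes> inv (\<alpha> [^] s' \<otimes> \<beta> [^] t')"
      by (simp add: int_pow_diff inv_mult m_ac)
    also have "\<dots> = \<one>" by (simp add: e)
    finally have "3 dvd s - s' \<and> 3 dvd t - t'" by (rule indep)
    then show "s = s' \<and> t = t'" using r by auto presburger+
  qed
  then have "card (?f ` ({0..2} \<times> {0..2})) = 9"
    by (simp add: card_image card_cartesian_product)
  moreover have "?f ` ({0..2} \<times> {0..2}) \<subseteq> P"
  proof clarify
    fix s t :: int
    have "\<alpha> [^] s \<otimes> \<beta> [^] t = (a [^] s \<otimes> b [^] t) [^] m"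
      using abc unfolding \<alpha>_def \<beta>_def
      by (simp add: int_pow_distrib int_pow_pow mult.commute flip: int_pow_int)
    then show "\<alpha> [^] s \<otimes> \<beta> [^] t \<in> P"
      using abc unfolding P_def by blast
  qed
  moreover have "finite P" using fin by (simp add: P_def)
  ultimately have "9 \<le> card P" by (metis card_mono)
  moreover have "card (P - ?\<Sigma>) \<le> card {\<alpha> [^] (1::int) \<otimes> \<beta> [^] (2::int), \<alpha> [^] (2::int) \<otimes> \<beta> [^] (1::int)}"
    using outside by (intro card_mono) auto
  moreover have "\<dots> \<le> 2" by (simp add: card_insert_if)
  ultimately show ?thesis by linarith
qed

text \<open>This carries the proportion \<open>2/9\<close> from a quotient back to the group.\<close>
lemma (in group_hom) card_hom_preimage:
  assumes fin: "finite (carrier G)" and Q: "Q \<subseteq> h ` carrier G"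
  shows "card {x \<in> carrier G. h x \<in> Q} = card (kernel G H h) * card Q"
proof -
  have fiber: "card {x \<in> carrier G. h x = q} = card (kernel G H h)" if q: "q \<in> Q" for q
  proof -
    obtain x where x: "x \<in> carrier G" "q = h x" using subsetD[OF Q q] by blast
    have "bij_betw (\<lambda>k. k \<otimes> x) (kernel G H h) {y \<in> carrier G. h y = q}"
      by (rule bij_betwI[where g = "\<lambda>y. y \<otimes> inv x"])
         (use x in \<open>auto simp: kernel_def G.m_assoc\<close>)
    then show ?thesis by (simp add: bij_betw_same_card)
  qed
  have "{x \<in> carrier G. h x \<in> Q} = (\<Union>q\<in>Q. {x \<in> carrier G. h x = q})" by auto
  also have "card \<dots> = (\<Sum>q\<in>Q. card {x \<in> carrier G. h x = q})"
    using fin Q by (intro card_UN_disjoint) (auto intro: finite_subset)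
  finally show ?thesis by (simp add: fiber mult.commute)
qed

lemma (in comm_group) Mod_exponent:
  assumes K: "K \<lhd> G" and exp: "\<And>x. x \<in> carrier G \<Longrightarrow> x [^] (k :: nat) = \<one>"
    and Y: "Y \<in> carrier (G Mod K)"
  shows "Y [^]\<^bsub>G Mod K\<^esub> k = \<one>\<^bsub>G Mod K\<^esub>"
proof -
  obtain x where "x \<in> carrier G" "Y = K #> x" using Y by (auto simp: carrier_FactGroup)
  then show ?thesis
    using normal.FactGroup_pow[OF K] exp coset_join2[OF one_closed]
      normal.axioms(1)[OF K] subgroup.one_closed by force
qed

lemma (in comm_group) involutions_in_quotient_preimage:
  fixes m :: nat
  assumes K: "K \<lhd> G" and S: "generating_triple (G Mod K) S"
    and exp: "\<And>x. x \<in> carrier G \<Longrightarrow> x [^] (2 * m) = \<one>" and g: "g \<in> carrier G"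
  shows "g [^] m \<in> quotient_preimage G K (stabilizer_set (G Mod K) S)"
proof -
  interpret H: comm_group "G Mod K"
    by (rule abelian_FactGroup[OF normal.axioms(1)[OF K]])
  obtain a b c where abc: "S = (a, b, c)" by (cases S)
  have "(K #> g) [^]\<^bsub>G Mod K\<^esub> m \<in> stabilizer_set (G Mod K) S"
    unfolding abc using S g Mod_exponent[OF K exp]
    by (intro H.involutions_in_stabilizer_set) (auto simp: abc carrier_FactGroup)
  then show ?thesis
    using g by (simp add: quotient_preimage_def normal.FactGroup_pow[OF K])
qed

text \<open>The map \<open>g \<mapsto> K g\<^sup>m\<close> is a homomorphism onto the \<open>m\<close>-th powers of the quotient, so the proportion of
  group elements that it sends outside the stabilizer set is the one bounded above.\<close>
lemma (in comm_group) few_cubic_powers_outside_quotient_preimage: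
  fixes m :: nat
  assumes fin: "finite (carrier G)" and K: "K \<lhd> G" and S: "generating_triple (G Mod K) S"
    and exp: "\<And>x. x \<in> carrier G \<Longrightarrow> x [^] (3 * m) = \<one>"
  shows "9 * card {g \<in> carrier G. g [^] m \<notin> quotient_preimage G K (stabilizer_set (G Mod K) S)}
    \<le> 2 * card (carrier G)"
proof -
  interpret H: comm_group "G Mod K"
    by (rule abelian_FactGroup[OF normal.axioms(1)[OF K]])
  obtain a b c where abc: "S = (a, b, c)" by (cases S)
  define \<phi> where "\<phi> = (\<lambda>g. (K #> g) [^]\<^bsub>G Mod K\<^esub> m)"
  let ?P = "(\<lambda>Y. Y [^]\<^bsub>G Mod K\<^esub> m) ` carrier (G Mod K)"
  let ?\<Sigma> = "stabilizer_set (G Mod K) S"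
  have "\<phi> \<in> hom G (G Mod K)"
    using normal.r_coset_hom_Mod[OF K] unfolding \<phi>_def hom_def
    by (auto simp: H.nat_pow_distrib Pi_iff simp del: mult_FactGroup)
  then interpret \<phi>: group_hom G "G Mod K" \<phi>
    by unfold_locales
  have P: "?P = \<phi> ` carrier G"
    by (simp add: \<phi>_def carrier_FactGroup image_image)
  have "9 * card (?P - ?\<Sigma>) \<le> 2 * card ?P"
    unfolding abc
    by (rule H.few_cubic_powers_outside_stabilizer_set)
       (use fin S Mod_exponent[OF K exp] in \<open>auto simp: abc carrier_FactGroup\<close>)
  then have "9 * (k * card (?P - ?\<Sigma>)) \<le> 2 * (k * card ?P)" for k :: nat
    using mult_le_mono2[of "9 * card (?P - ?\<Sigma>)" "2 * card ?P" k] by (simp add: mult_ac)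
  moreover have "card {g \<in> carrier G. \<phi> g \<in> ?P - ?\<Sigma>} = card (kernel G (G Mod K) \<phi>) * card (?P - ?\<Sigma>)"
    by (rule \<phi>.card_hom_preimage[OF fin]) (use P in blast)
  moreover have "card {g \<in> carrier G. \<phi> g \<in> ?P} = card (kernel G (G Mod K) \<phi>) * card ?P"
    by (rule \<phi>.card_hom_preimage[OF fin]) (use P in blast)
  moreover have "{g \<in> carrier G. \<phi> g \<in> ?P} = carrier G"
    unfolding P by blast
  moreover have "{g \<in> carrier G. \<phi> g \<in> ?P - ?\<Sigma>}
      = {g \<in> carrier G. g [^] m \<notin> quotient_preimage G K ?\<Sigma>}"
    unfolding P by (auto simp: quotient_preimage_def \<phi>_def normal.FactGroup_pow[OF K])
  ultimately show ?thesis by (simp only:)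
qed

lemma beauville_structure3D:
  assumes "beauville_structure3 G S K" and "i \<in> {1, 2, 3}"
  shows "K i \<lhd> G" and "generating_triple (G Mod K i) (S i)"
proof -
  from assms(1) have "\<forall>i\<in>{1, 2, 3}. K i \<lhd> G"
    unfolding beauville_structure3_def by (elim conjE)
  moreover from assms(1) have
    "\<forall>i\<in>{1, 2, 3}. generating_triple (G Mod K i) (S i) \<and> hyperbolic (G Mod K i) (S i)"
    unfolding beauville_structure3_def by (elim conjE)
  ultimately show "K i \<lhd> G" "generating_triple (G Mod K i) (S i)"
    using assms(2) by metis+
qed

lemma (in comm_group) beauville_structure3_exponent_even:
  fixes m :: nat
  assumes B: "beauville_structure3 G S K"
    and exp: "\<And>x. x \<in> carrier G \<Longrightarrow> x [^] (2 * m) = \<one>" and g: "g \<in> carrier G"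
  shows "g [^] m = \<one>"
proof -
  have "g [^] m \<in> quotient_preimage G (K i) (stabilizer_set (G Mod K i) (S i))"
    if "i \<in> {1, 2, 3}" for i
  proof -
    have "K i \<lhd> G" "generating_triple (G Mod K i) (S i)"
      by (rule beauville_structure3D[OF B that])+
    then show ?thesis by (rule involutions_in_quotient_preimage[OF _ _ exp g])
  qed
  then have "g [^] m \<in> (\<Inter>i\<in>{1, 2, 3}. quotient_preimage G (K i) (stabilizer_set (G Mod K i) (S i)))"
    by (rule INT_I)
  moreover have "(\<Inter>i\<in>{1, 2, 3}. quotient_preimage G (K i) (stabilizer_set (G Mod K i) (S i))) = {\<one>}"
    using B unfolding beauville_structure3_def by (elim conjE)
  ultimately show ?thesis by (simp only: singleton_iff)
qed

text \<open>Three exceptional sets of proportion at most \<open>2/9\<close> leave at least a third of the group for the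
  kernel of \<open>g \<mapsto> g\<^sup>m\<close>, whose index is the number of \<open>m\<close>-th powers.\<close>
lemma (in comm_group) beauville_structure3_exponent_triple:
  fixes m :: nat
  assumes B: "beauville_structure3 G S K"
    and exp: "\<And>x. x \<in> carrier G \<Longrightarrow> x [^] (3 * m) = \<one>"
  shows "card ((\<lambda>x. x [^] m) ` carrier G) \<le> 3"
proof -
  have fin: "finite (carrier G)"
    using B by (simp add: beauville_structure3_def)
  define W where "W i = quotient_preimage G (K i) (stabilizer_set (G Mod K i) (S i))" for i
  define M where "M i = {g \<in> carrier G. g [^] m \<notin> W i}" for i
  have M: "9 * card (M i) \<le> 2 * card (carrier G)" if "i \<in> {1, 2, 3}" for i
  proof -
    have "K i \<lhd> G" "generating_triple (G Mod K i) (S i)"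
      by (rule beauville_structure3D[OF B that])+
    then show ?thesis
      unfolding M_def W_def by (rule few_cubic_powers_outside_quotient_preimage[OF fin _ _ exp])
  qed
  interpret pow: group_hom G G "\<lambda>x. x [^] m"
    by unfold_locales (auto simp: hom_def nat_pow_distrib)
  let ?N = "kernel G G (\<lambda>x. x [^] m)"
  have "(\<Inter>i\<in>{1, 2, 3}. W i) = {\<one>}"
    using B unfolding beauville_structure3_def W_def by (elim conjE)
  then have "carrier G \<subseteq> M 1 \<union> M 2 \<union> M 3 \<union> ?N"
    by (auto simp: M_def kernel_def)
  moreover have "finite (M i)" for i using fin by (simp add: M_def)
  moreover have "finite ?N" using fin by (simp add: kernel_def)
  ultimately have "card (carrier G) \<le> card (M 1 \<union> M 2 \<union> M 3 \<union> ?N)"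
    by (intro card_mono) auto
  also have "\<dots> \<le> card (M 1) + card (M 2) + card (M 3) + card ?N"
    by (meson add_le_mono1 card_Un_le order_trans)
  finally have "card (carrier G) \<le> 3 * card ?N"
    using M[of 1] M[of 2] M[of 3] by simp
  moreover have "card (carrier G) = card ?N * card ((\<lambda>x. x [^] m) ` carrier G)"
    using pow.card_hom_preimage[OF fin, of "(\<lambda>x. x [^] m) ` carrier G"] by (simp add: Collect_conj_eq Int_absorb2 subset_iff)
  moreover have "card ?N > 0"
    using \<open>finite ?N\<close> by (auto simp: card_gt_0_iff kernel_def)
  ultimately show ?thesis by simp
qed

section \<open>Generating triples of quotients\<close>

text \<open>The conditions on a triple of cosets, expressed through representatives in \<open>G\<close>. Three orders of at
  least \<open>4\<close> have reciprocal sum at most \<open>3/4\<close>, which makes the triple hyperbolic.\<close>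
lemma (in comm_group) quotient_generating_triple:
  assumes fin: "finite (carrier G)" and K: "subgroup K G"
    and abc: "a \<in> carrier G" "b \<in> carrier G" "c \<in> carrier G" "a \<otimes> b \<otimes> c = \<one>"
    and gen: "\<forall>g\<in>carrier G. \<exists>k\<in>K. \<exists>(s :: int) (t :: int). g = k \<otimes> (a [^] s \<otimes> b [^] t)"
    and big: "\<forall>x\<in>{a, b, c}. \<forall>d :: nat. d > 0 \<longrightarrow> x [^] d \<in> K \<longrightarrow> d > 3"
  shows "generating_triple (G Mod K) (K #> a, K #> b, K #> c)"
    and "hyperbolic (G Mod K) (K #> a, K #> b, K #> c)"
    and "\<one> \<in> quotient_preimage G K (stabilizer_set (G Mod K) (K #> a, K #> b, K #> c))"
    and "g \<in> quotient_preimage G K (stabilizer_set (G Mod K) (K #> a, K #> b, K #> c)) \<Longrightarrow>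
      \<exists>k\<in>K. \<exists>x\<in>{a, b, c}. \<exists>s :: int. g = k \<otimes> x [^] s"
proof -
  note N = subgroup_imp_normal[OF K]
  interpret H: comm_group "G Mod K"
    by (rule abelian_FactGroup[OF K])
  have carr: "K #> x \<in> carrier (G Mod K)" if "x \<in> carrier G" for x
    using that by (auto simp: carrier_FactGroup)
  have fin': "finite (carrier (G Mod K))"
    using fin by (simp add: carrier_FactGroup)
  have in_K: "x \<in> K" if "K #> x = K" "x \<in> carrier G" for x
    using coset_join1[OF that K] .
  have mult: "(K #> x) \<otimes>\<^bsub>G Mod K\<^esub> (K #> y) = K #> (x \<otimes> y)" if "x \<in> carrier G" "y \<in> carrier G" for x y
    using normal.rcos_sum[OF N that] by simp
  have ord: "H.ord (K #> x) > 3" if x: "x \<in> {a, b, c}" for x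
  proof -
    have xG: "x \<in> carrier G" using x abc by blast
    have "(K #> x) [^]\<^bsub>G Mod K\<^esub> H.ord (K #> x) = \<one>\<^bsub>G Mod K\<^esub>"
      by (rule H.pow_ord_eq_1[OF carr[OF xG]])
    then have "x [^] H.ord (K #> x) \<in> K"
      using xG in_K by (simp add: normal.FactGroup_pow[OF N])
    then show ?thesis
      using bspec[OF big x] H.ord_ge_1[OF fin' carr[OF xG]] by simp
  qed
  have nontriv: "K #> x \<noteq> \<one>\<^bsub>G Mod K\<^esub>" if x: "x \<in> {a, b, c}" for x
  proof
    have xG: "x \<in> carrier G" using x abc by blast
    assume "K #> x = \<one>\<^bsub>G Mod K\<^esub>"
    then have "x [^] (1 :: nat) \<in> K"
      using in_K[OF _ xG] xG by simp
    then show False using bspec[OF big x, rule_format, of 1] by simp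
  qed
  have "generate (G Mod K) {K #> a, K #> b, K #> c} = carrier (G Mod K)"
  proof
    let ?L = "generate (G Mod K) {K #> a, K #> b, K #> c}"
    have sub: "subgroup ?L (G Mod K)"
      by (rule H.generate_is_subgroup) (use abc carr in auto)
    then show "?L \<subseteq> carrier (G Mod K)" by (rule subgroup.subset)
    show "carrier (G Mod K) \<subseteq> ?L"
    proof
      fix Y assume "Y \<in> carrier (G Mod K)"
      then obtain g where g: "g \<in> carrier G" "Y = K #> g" by (auto simp: carrier_FactGroup)
      obtain k s t where k: "k \<in> K" and gk: "g = k \<otimes> (a [^] (s::int) \<otimes> b [^] (t::int))"
        using bspec[OF gen g(1)] by blast
      have kG: "k \<in> carrier G" using k subgroup.mem_carrier[OF K] by blast
      have "Y = (K #> k) \<otimes>\<^bsub>G Mod K\<^esub> ((K #> a [^] s) \<otimes>\<^bsub>G Mod K\<^esub> (K #> b [^] t))"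
        unfolding g(2) gk by (simp only: mult kG abc m_closed int_pow_closed)
      also have "K #> k = \<one>\<^bsub>G Mod K\<^esub>"
        using coset_join2[OF kG K k] by simp
      also have "\<one>\<^bsub>G Mod K\<^esub> \<otimes>\<^bsub>G Mod K\<^esub> ((K #> a [^] s) \<otimes>\<^bsub>G Mod K\<^esub> (K #> b [^] t))
          = (K #> a) [^]\<^bsub>G Mod K\<^esub> s \<otimes>\<^bsub>G Mod K\<^esub> (K #> b) [^]\<^bsub>G Mod K\<^esub> t"
        using abc carr by (simp add: normal.FactGroup_int_pow[OF N] del: mult_FactGroup one_FactGroup)
      also have "\<dots> \<in> ?L"
        using sub by (intro subgroup.m_closed[OF sub] H.subgroup_int_pow_closed[OF sub] generate.incl) auto
      finally show "Y \<in> ?L" .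
    qed
  qed
  moreover have "(K #> a) \<otimes>\<^bsub>G Mod K\<^esub> (K #> b) \<otimes>\<^bsub>G Mod K\<^esub> (K #> c) = \<one>\<^bsub>G Mod K\<^esub>"
    using abc mult coset_join2[OF one_closed K subgroup.one_closed[OF K]]
    by (simp del: mult_FactGroup)
  moreover have "{K #> a, K #> b, K #> c} \<subseteq> carrier (G Mod K) - {\<one>\<^bsub>G Mod K\<^esub>}"
    using carr[OF abc(1)] carr[OF abc(2)] carr[OF abc(3)] nontriv[of a] nontriv[of b] nontriv[of c]
    by (simp only: insert_subset empty_subsetI Diff_iff insert_iff empty_iff simp_thms)
  ultimately show "generating_triple (G Mod K) (K #> a, K #> b, K #> c)"
    unfolding generating_triple_def prod.case
    using H.is_group fin' by (intro conjI)
  have "1 / real (H.ord (K #> x)) \<le> 1 / 4" if "x \<in> {a, b, c}" for x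
    using ord[OF that] by (intro divide_left_mono) auto
  from this[of a] this[of b] this[of c]
  show "hyperbolic (G Mod K) (K #> a, K #> b, K #> c)"
    unfolding hyperbolic_def prod.case by simp
  note stab = H.stabilizer_set_comm[OF carr[OF abc(1)] carr[OF abc(2)] carr[OF abc(3)]]
  have "K #> \<one> = (K #> a) [^]\<^bsub>G Mod K\<^esub> (0 :: int)"
    using coset_join2[OF one_closed K subgroup.one_closed[OF K]] by simp
  then show "\<one> \<in> quotient_preimage G K (stabilizer_set (G Mod K) (K #> a, K #> b, K #> c))"
    unfolding stab quotient_preimage_def by blast
  show "\<exists>k\<in>K. \<exists>x\<in>{a, b, c}. \<exists>s :: int. g = k \<otimes> x [^] s"
    if "g \<in> quotient_preimage G K (stabilizer_set (G Mod K) (K #> a, K #> b, K #> c))"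
  proof -
    from that obtain x and s :: int where g: "g \<in> carrier G" and x: "x \<in> {a, b, c}"
      and gx: "K #> g = (K #> x) [^]\<^bsub>G Mod K\<^esub> s"
      unfolding stab quotient_preimage_def by blast
    have "x \<in> carrier G" using x abc by blast
    then have "g \<in> K #> x [^] s"
      using rcos_self[OF g K] gx by (simp add: normal.FactGroup_int_pow[OF N])
    then show ?thesis
      using x unfolding r_coset_def by blast
  qed
qed

text \<open>When \<open>G/K\<close> is free over \<open>\<int>/n\<close> on the images of \<open>e\<close> and \<open>f\<close>, the elements \<open>(r, 1)\<close>, \<open>(-r, 1)\<close>, \<open>(0, -2)\<close>
  sum to zero, and the first two have determinant \<open>2r\<close>: they generate exactly when \<open>2r\<close> is a unit.
  Their multiples lie on the lines of slope \<open>r\<close>, \<open>-r\<close> and \<open>0\<close>.\<close>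
lemma (in comm_group) slope_triple:
  fixes r :: int and n :: nat
  assumes fin: "finite (carrier G)" and K: "subgroup K G"
    and ef: "e \<in> carrier G" "f \<in> carrier G" "e [^] n = \<one>" "f [^] n = \<one>"
    and indep: "\<And>(u :: int) (v :: int). e [^] u \<otimes> f [^] v \<in> K \<Longrightarrow> int n dvd u \<and> int n dvd v"
    and span: "\<And>g. g \<in> carrier G \<Longrightarrow> \<exists>k\<in>K. \<exists>(u :: int) (v :: int). g = k \<otimes> (e [^] u \<otimes> f [^] v)"
    and n: "n > 3" and cop: "coprime (2 * r) (int n)"
  obtains S where "generating_triple (G Mod K) S" "hyperbolic (G Mod K) S"
    "\<one> \<in> quotient_preimage G K (stabilizer_set (G Mod K) S)"
    "\<And>g. g \<in> quotient_preimage G K (stabilizer_set (G Mod K) S) \<Longrightarrow>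
      \<exists>k\<in>K. \<exists>\<epsilon>\<in>{-1, 0, 1}. \<exists>v :: int. g = k \<otimes> (e [^] (\<epsilon> * r * v) \<otimes> f [^] v)"
proof -
  define a b c where "a = e [^] r \<otimes> f" and "b = e [^] (- r) \<otimes> f" and "c = f [^] (-2 :: int)"
  have abc: "a \<in> carrier G" "b \<in> carrier G" "c \<in> carrier G"
    using ef by (auto simp: a_def b_def c_def)
  have pow: "(e [^] u \<otimes> f [^] v) [^] s = e [^] (u * s) \<otimes> f [^] (v * s)" for u v s :: int
    using ef by (simp add: int_pow_distrib int_pow_pow)
  have mult: "(e [^] u \<otimes> f [^] v) \<otimes> (e [^] u' \<otimes> f [^] v') = e [^] (u + u') \<otimes> f [^] (v + v')"
    for u v u' v' :: int
    using ef by (simp add: int_pow_mult m_ac)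
  have a: "a = e [^] r \<otimes> f [^] (1 :: int)" and b: "b = e [^] (- r) \<otimes> f [^] (1 :: int)"
    and c: "c = e [^] (0 :: int) \<otimes> f [^] (-2 :: int)"
    using ef by (simp_all add: a_def b_def c_def)
  have prod: "a \<otimes> b \<otimes> c = \<one>"
    unfolding a b c mult by simp
  have "coprime 2 (int n)"
    using cop by simp
  have gen: "\<exists>k\<in>K. \<exists>(s :: int) (t :: int). g = k \<otimes> (a [^] s \<otimes> b [^] t)" if g: "g \<in> carrier G" for g
  proof -
    obtain k and u v :: int where k: "k \<in> K" and guv: "g = k \<otimes> (e [^] u \<otimes> f [^] v)"
      using span[OF g] by blast
    obtain w z where "w * (2 * r) + z * int n = 1"
      using bezout_int[of "2 * r" "int n"] cop by auto
    then have q: "2 * r * w = 1 + int n * (- z)" by (simp add: algebra_simps)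
    \<comment> \<open>Solving \<open>r(s - t) = u\<close> and \<open>s + t = v\<close> modulo \<open>n\<close>, with \<open>w\<close> the inverse of \<open>2r\<close>.\<close>
    define s t where "s = w * (u + r * v)" and "t = w * (r * v - u)"
    have "r * s + - r * t = u + int n * (- z * u)" "1 * s + 1 * t = v + int n * (- z * v)"
    proof -
      have "r * s + - r * t = (2 * r * w) * u" "1 * s + 1 * t = (2 * r * w) * v"
        by (simp_all add: s_def t_def algebra_simps)
      then show "r * s + - r * t = u + int n * (- z * u)" "1 * s + 1 * t = v + int n * (- z * v)"
        unfolding q by (simp_all add: algebra_simps)
    qed
    moreover have "x [^] (u + int n * z) = x [^] u" if "x \<in> carrier G" "x [^] n = \<one>" for x and u z :: int
      using that by (metis int_pow_mod mod_mult_self2)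
    ultimately have "a [^] s \<otimes> b [^] t = e [^] u \<otimes> f [^] v"
      unfolding a b pow mult using ef by (simp only:)
    then show ?thesis using k guv by metis
  qed
  have big: "d > 3" if x: "x \<in> {a, b, c}" and d: "d > 0" "x [^] d \<in> K" for x and d :: nat
  proof -
    obtain u v :: int where xuv: "x = e [^] u \<otimes> f [^] v" and v: "v = 1 \<or> v = -2"
      using x a b c by blast
    \<comment> \<open>The second coordinate is a unit in all three cases, so the order is a multiple of \<open>n\<close>.\<close>
    have "e [^] (u * int d) \<otimes> f [^] (v * int d) \<in> K"
      using d(2) pow unfolding xuv int_pow_int[symmetric] by simp
    then have "int n dvd v * int d" using indep by blast
    moreover have "coprime (int n) v"
      using v \<open>coprime 2 (int n)\<close> by (auto simp: coprime_commute)
    ultimately have "int n dvd int d"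
      by (simp add: coprime_dvd_mult_right_iff)
    then show ?thesis using d(1) n by (auto dest: dvd_imp_le)
  qed
  have gen': "\<forall>g\<in>carrier G. \<exists>k\<in>K. \<exists>(s :: int) (t :: int). g = k \<otimes> (a [^] s \<otimes> b [^] t)"
    and big': "\<forall>x\<in>{a, b, c}. \<forall>d :: nat. d > 0 \<longrightarrow> x [^] d \<in> K \<longrightarrow> d > 3"
    using gen big by blast+
  note q = quotient_generating_triple[OF fin K abc prod gen' big']
  show thesis
  proof (rule that[OF q(1-3)])
    fix g assume gq: "g \<in> quotient_preimage G K (stabilizer_set (G Mod K) (K #> a, K #> b, K #> c))"
    obtain k x and s :: int where k: "k \<in> K" and x: "x \<in> {a, b, c}" and g: "g = k \<otimes> x [^] s"
      using q(4)[OF gq] by blast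
    obtain \<epsilon> v :: int where "\<epsilon> \<in> {-1, 0, 1}" "x = e [^] (\<epsilon> * r * v) \<otimes> f [^] v"
    proof -
      from x consider "x = a" | "x = b" | "x = c" by blast
      then show thesis
      proof cases
        case 1 show thesis by (rule that[of 1 1]) (simp_all add: 1 a)
      next
        case 2 show thesis by (rule that[of "-1" 1]) (simp_all add: 2 b)
      next
        case 3 show thesis by (rule that[of 0 "-2"]) (simp_all add: 3 c)
      qed
    qed
    then have "\<epsilon> \<in> {-1, 0, 1}" "g = k \<otimes> (e [^] (\<epsilon> * r * (v * s)) \<otimes> f [^] (v * s))"
      using pow g by (simp_all add: mult.assoc)
    with k show "\<exists>k\<in>K. \<exists>\<epsilon>\<in>{-1, 0, 1}. \<exists>v :: int. g = k \<otimes> (e [^] (\<epsilon> * r * v) \<otimes> f [^] v)"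
      by blast
  qed
qed

section \<open>Three slopes in each coordinate plane\<close>

definition (in comm_group) is_basis3 :: "nat \<Rightarrow> 'a \<Rightarrow> 'a \<Rightarrow> 'a \<Rightarrow> bool" where
  "is_basis3 n d e f \<longleftrightarrow>
     d \<in> carrier G \<and> e \<in> carrier G \<and> f \<in> carrier G \<and> d [^] n = \<one> \<and> e [^] n = \<one> \<and> f [^] n = \<one> \<and>
     (\<forall>g\<in>carrier G. \<exists>(x :: int) (y :: int) (z :: int). g = d [^] x \<otimes> (e [^] y \<otimes> f [^] z)) \<and>
     (\<forall>(x :: int) (y :: int) (z :: int). d [^] x \<otimes> (e [^] y \<otimes> f [^] z) = \<one> \<longrightarrow>
        int n dvd x \<and> int n dvd y \<and> int n dvd z)"

context comm_group
begin

context
  fixes n d e f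
  assumes basis: "is_basis3 n d e f"
begin

lemma basis3_closed: "d \<in> carrier G" "e \<in> carrier G" "f \<in> carrier G"
  and basis3_pow: "d [^] n = \<one>" "e [^] n = \<one>" "f [^] n = \<one>"
  using basis by (simp_all add: is_basis3_def)

lemma basis3_span:
  assumes "g \<in> carrier G"
  obtains x y z :: int where "g = d [^] x \<otimes> (e [^] y \<otimes> f [^] z)"
  using basis assms that by (auto simp: is_basis3_def)

lemma basis3_indep:
  fixes x y z x' y' z' :: int
  assumes "d [^] x \<otimes> (e [^] y \<otimes> f [^] z) = d [^] x' \<otimes> (e [^] y' \<otimes> f [^] z')"
  shows "int n dvd x - x'" "int n dvd y - y'" "int n dvd z - z'"
proof -
  have "d [^] (x - x') \<otimes> (e [^] (y - y') \<otimes> f [^] (z - z'))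
      = (d [^] x \<otimes> (e [^] y \<otimes> f [^] z)) \<otimes> inv (d [^] x' \<otimes> (e [^] y' \<otimes> f [^] z'))"
    using basis3_closed by (simp add: int_pow_diff inv_mult m_ac)
  also have "\<dots> = \<one>"
    unfolding assms using basis3_closed by simp
  finally show "int n dvd x - x'" "int n dvd y - y'" "int n dvd z - z'"
    using basis by (auto simp: is_basis3_def)
qed

text \<open>Cyclic symmetry lets a single lemma about the first axis serve all three.\<close>
lemma basis3_rotate: "is_basis3 n e f d"
proof -
  have rot: "e [^] y \<otimes> (f [^] z \<otimes> d [^] x) = d [^] x \<otimes> (e [^] y \<otimes> f [^] z)" for x y z :: int
    using basis3_closed by (simp add: m_ac)
  have "\<exists>(y :: int) (z :: int) (x :: int). g = e [^] y \<otimes> (f [^] z \<otimes> d [^] x)" if "g \<in> carrier G" for g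
    unfolding rot using basis3_span[OF that] by metis
  moreover have "int n dvd y \<and> int n dvd z \<and> int n dvd x"
    if "e [^] y \<otimes> (f [^] z \<otimes> d [^] x) = \<one>" for x y z :: int
    using basis3_indep[of x y z 0 0 0] that unfolding rot by simp
  ultimately show ?thesis
    unfolding is_basis3_def using basis3_closed basis3_pow by blast
qed

lemma basis3_axes_disjoint: "generate G {d} \<inter> generate G {e} = {\<one>}"
proof (intro equalityI subsetI)
  fix g assume "g \<in> generate G {d} \<inter> generate G {e}"
  then obtain s t :: int where g: "g = d [^] s" "g = e [^] t"
    unfolding generate_pow[OF basis3_closed(1)] generate_pow[OF basis3_closed(2)] by blast
  then have "d [^] s \<otimes> (e [^] (0::int) \<otimes> f [^] (0::int)) = d [^] (0::int) \<otimes> (e [^] t \<otimes> f [^] (0::int))"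
    using basis3_closed by simp
  from basis3_indep(1)[OF this] have "s mod int n = 0" by simp
  then show "g \<in> {\<one>}"
    using g(1) int_pow_mod[OF basis3_closed(1) basis3_pow(1), of s] by simp
qed (auto intro: generate.one)

text \<open>The case \<open>\<epsilon> = 0\<close> is the coordinate axis spanned by \<open>f\<close>. Using an axis is essential modulo \<open>5\<close>: there are
  only four invertible slopes, and among any three of them for each of the three planes there is a
  choice with product \<open>1\<close>, which yields a nontrivial common point.\<close>
lemma basis3_slope_triple:
  assumes fin: "finite (carrier G)" and n: "n > 3" and cop: "coprime (2 * r) (int n)"
  defines "K \<equiv> generate G {d}"
  shows "\<exists>S. generating_triple (G Mod K) S \<and> hyperbolic (G Mod K) S \<and>
    \<one> \<in> quotient_preimage G K (stabilizer_set (G Mod K) S) \<and>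
    (\<forall>(x :: int) (y :: int) (z :: int).
      d [^] x \<otimes> (e [^] y \<otimes> f [^] z) \<in> quotient_preimage G K (stabilizer_set (G Mod K) S) \<longrightarrow>
      (\<exists>\<epsilon>\<in>{-1, 0, 1}. int n dvd y - \<epsilon> * r * z))"
proof -
  have K_eq: "K = range (\<lambda>t :: int. d [^] t)"
    using basis3_closed by (auto simp: K_def generate_pow)
  have K: "subgroup K G"
    using basis3_closed by (auto simp: K_def intro: generate_is_subgroup)
  have indep: "int n dvd u \<and> int n dvd v" if "e [^] u \<otimes> f [^] v \<in> K" for u v :: int
  proof -
    obtain t :: int where "e [^] u \<otimes> f [^] v = d [^] t" using \<open>e [^] u \<otimes> f [^] v \<in> K\<close> K_eq by blast
    then have "d [^] (0::int) \<otimes> (e [^] u \<otimes> f [^] v) = d [^] t \<otimes> (e [^] (0::int) \<otimes> f [^] (0::int))"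
      using basis3_closed by simp
    from basis3_indep(2,3)[OF this] show ?thesis by simp
  qed
  have span: "\<exists>k\<in>K. \<exists>(u :: int) (v :: int). g = k \<otimes> (e [^] u \<otimes> f [^] v)" if "g \<in> carrier G" for g
    using basis3_span[OF that] unfolding K_eq by blast
  obtain S where S: "generating_triple (G Mod K) S" "hyperbolic (G Mod K) S"
    "\<one> \<in> quotient_preimage G K (stabilizer_set (G Mod K) S)"
    and pre: "\<And>g. g \<in> quotient_preimage G K (stabilizer_set (G Mod K) S) \<Longrightarrow>
      \<exists>k\<in>K. \<exists>\<epsilon>\<in>{-1, 0, 1}. \<exists>v :: int. g = k \<otimes> (e [^] (\<epsilon> * r * v) \<otimes> f [^] v)"
    using slope_triple[OF fin K basis3_closed(2,3) basis3_pow(2,3) indep span n cop] by blast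
  show ?thesis
  proof (intro exI[of _ S] conjI S allI impI)
    fix x y z :: int
    assume "d [^] x \<otimes> (e [^] y \<otimes> f [^] z) \<in> quotient_preimage G K (stabilizer_set (G Mod K) S)"
    from pre[OF this] obtain t \<epsilon> v :: int where \<epsilon>: "\<epsilon> \<in> {-1, 0, 1}"
      and "d [^] x \<otimes> (e [^] y \<otimes> f [^] z) = d [^] t \<otimes> (e [^] (\<epsilon> * r * v) \<otimes> f [^] v)"
      unfolding K_eq by blast
    from basis3_indep(2,3)[OF this(2)] have "int n dvd (y - \<epsilon> * r * v) - (\<epsilon> * r) * (z - v)"
      by (rule dvd_diff[OF _ dvd_mult])
    then have "int n dvd y - \<epsilon> * r * z" by (simp add: algebra_simps)
    with \<epsilon> show "\<exists>\<epsilon>\<in>{-1, 0, 1}. int n dvd y - \<epsilon> * r * z" by blast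
  qed
qed

end

text \<open>The slopes \<open>\<plusminus>1\<close>, \<open>\<plusminus>1\<close>, \<open>\<plusminus>2\<close> multiply to \<open>\<plusminus>2\<close>, which is never \<open>1\<close> modulo a prime other than \<open>3\<close>, and
  a product with a zero slope vanishes: going once around the three coordinate planes therefore forces a common point to be the origin.\<close>
lemma basis3_has_beauville_structure3:
  assumes basis: "is_basis3 n e1 e2 e3" and fin: "finite (carrier G)" and n: "n > 3"
    and cop2: "coprime 2 (int n)" and cop3: "coprime 3 (int n)"
  shows "has_beauville_structure3 G"
proof -
  note basis' = basis3_rotate[OF basis]
  note basis'' = basis3_rotate[OF basis']
  note closed = basis3_closed[OF basis]
  let ?pre = "\<lambda>K S. quotient_preimage G K (stabilizer_set (G Mod K) S)"
  let ?good = "\<lambda>K S. generating_triple (G Mod K) S \<and> hyperbolic (G Mod K) S \<and> \<one> \<in> ?pre K S"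
  let ?K1 = "generate G {e1}" and ?K2 = "generate G {e2}" and ?K3 = "generate G {e3}"
  have cop: "coprime (2 * 1) (int n)" "coprime (2 * 2) (int n)"
    using cop2 by (simp_all only: coprime_mult_left_iff coprime_1_left simp_thms)
  obtain S1 where S1: "?good ?K1 S1" and pre1: "\<forall>(x :: int) (y :: int) (z :: int).
      e1 [^] x \<otimes> (e2 [^] y \<otimes> e3 [^] z) \<in> ?pre ?K1 S1 \<longrightarrow> (\<exists>\<epsilon>\<in>{-1, 0, 1}. int n dvd y - \<epsilon> * 1 * z)"
    using basis3_slope_triple[OF basis fin n cop(1)] by blast
  obtain S2 where S2: "?good ?K2 S2" and pre2: "\<forall>(x :: int) (y :: int) (z :: int).
      e2 [^] x \<otimes> (e3 [^] y \<otimes> e1 [^] z) \<in> ?pre ?K2 S2 \<longrightarrow> (\<exists>\<epsilon>\<in>{-1, 0, 1}. int n dvd y - \<epsilon> * 1 * z)"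
    using basis3_slope_triple[OF basis' fin n cop(1)] by blast
  obtain S3 where S3: "?good ?K3 S3" and pre3: "\<forall>(x :: int) (y :: int) (z :: int).
      e3 [^] x \<otimes> (e1 [^] y \<otimes> e2 [^] z) \<in> ?pre ?K3 S3 \<longrightarrow> (\<exists>\<epsilon>\<in>{-1, 0, 1}. int n dvd y - \<epsilon> * 2 * z)"
    using basis3_slope_triple[OF basis'' fin n cop(2)] by blast
  have trivial: "g = \<one>" if g: "g \<in> ?pre ?K1 S1" "g \<in> ?pre ?K2 S2" "g \<in> ?pre ?K3 S3" for g
  proof -
    have "g \<in> carrier G" using g(1) by (simp add: quotient_preimage_def)
    then obtain x y z :: int where xyz: "g = e1 [^] x \<otimes> (e2 [^] y \<otimes> e3 [^] z)"
      by (rule basis3_span[OF basis])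
    have xyz': "g = e2 [^] y \<otimes> (e3 [^] z \<otimes> e1 [^] x)" "g = e3 [^] z \<otimes> (e1 [^] x \<otimes> e2 [^] y)"
      using closed by (simp_all add: xyz m_ac)
    obtain \<alpha> where \<alpha>: "\<alpha> \<in> {-1, 0, 1}" "int n dvd y - \<alpha> * 1 * z"
      using pre1 g(1) unfolding xyz by blast
    obtain \<beta> where \<beta>: "\<beta> \<in> {-1, 0, 1}" "int n dvd z - \<beta> * 1 * x"
      using pre2 g(2) unfolding xyz'(1) by blast
    obtain \<gamma> where \<gamma>: "\<gamma> \<in> {-1, 0, 1}" "int n dvd x - \<gamma> * 2 * y"
      using pre3 g(3) unfolding xyz'(2) by blast
    \<comment> \<open>Eliminating \<open>y\<close> and then \<open>z\<close> from the three relations.\<close>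
    have "int n dvd (x - \<gamma> * 2 * y) + (\<gamma> * 2) * (y - \<alpha> * 1 * z) + (\<gamma> * 2 * \<alpha>) * (z - \<beta> * 1 * x)"
      using \<alpha>(2) \<beta>(2) \<gamma>(2) by (intro dvd_add dvd_mult)
    also have "\<dots> = (1 - 2 * (\<alpha> * \<beta> * \<gamma>)) * x" by (simp add: algebra_simps)
    finally have "int n dvd (1 - 2 * (\<alpha> * \<beta> * \<gamma>)) * x" .
    moreover have "1 - 2 * (\<alpha> * \<beta> * \<gamma>) \<in> {-1, 1, 3}"
      using \<alpha>(1) \<beta>(1) \<gamma>(1) by auto
    moreover have "coprime (int n) w" if "w \<in> {-1, 1, 3}" for w
      using that cop3 by (auto simp: coprime_commute)
    ultimately have "int n dvd (1 - 2 * (\<alpha> * \<beta> * \<gamma>)) * x"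
      "coprime (int n) (1 - 2 * (\<alpha> * \<beta> * \<gamma>))" by blast+
    then have x: "int n dvd x" by (simp add: coprime_dvd_mult_right_iff)
    then have "int n dvd (z - \<beta> * 1 * x) + \<beta> * x"
      using \<beta>(2) by (intro dvd_add dvd_mult)
    then have z: "int n dvd z" by simp
    then have "int n dvd (y - \<alpha> * 1 * z) + \<alpha> * z"
      using \<alpha>(2) by (intro dvd_add dvd_mult)
    then have y: "int n dvd y" by simp
    have "e1 [^] x = \<one>" "e2 [^] y = \<one>" "e3 [^] z = \<one>"
      using x y z closed basis3_pow[OF basis]
      by (auto simp: int_pow_mod[of _ n])
    then show ?thesis by (simp add: xyz)
  qed
  define S where "S i = (if i = 1 then S1 else if i = 2 then S2 else S3)" for i :: nat
  define K where "K i = generate G {if i = 1 then e1 else if i = 2 then e2 else e3}" for i :: nat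
  have SK: "S 1 = S1" "S 2 = S2" "S 3 = S3" "K 1 = ?K1" "K 2 = ?K2" "K 3 = ?K3"
    by (simp_all add: S_def K_def)
  have "(\<Inter>i\<in>{1, 2, 3}. ?pre (K i) (S i)) = {\<one>}"
  proof (intro equalityI subsetI)
    fix g assume g: "g \<in> (\<Inter>i\<in>{1, 2, 3}. ?pre (K i) (S i))"
    have "g \<in> ?pre (K 1) (S 1)" "g \<in> ?pre (K 2) (S 2)" "g \<in> ?pre (K 3) (S 3)"
      by (rule INT_D[OF g], simp)+
    then show "g \<in> {\<one>}" using trivial unfolding SK by simp
  next
    have "\<one> \<in> ?pre (K 1) (S 1)" "\<one> \<in> ?pre (K 2) (S 2)" "\<one> \<in> ?pre (K 3) (S 3)"
      using S1 S2 S3 unfolding SK by simp_all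
    moreover fix g assume "g \<in> {\<one>}"
    ultimately show "g \<in> (\<Inter>i\<in>{1, 2, 3}. ?pre (K i) (S i))" by simp
  qed
  moreover have "\<forall>i\<in>{1, 2, 3}. K i \<lhd> G"
    unfolding K_def using closed by (intro ballI subgroup_imp_normal generate_is_subgroup) auto
  moreover have "\<forall>i\<in>{1, 2, 3}. generating_triple (G Mod K i) (S i) \<and> hyperbolic (G Mod K i) (S i)"
  proof
    fix i :: nat
    assume "i \<in> {1, 2, 3}"
    then consider "i = 1" | "i = 2" | "i = 3" by blast
    then show "generating_triple (G Mod K i) (S i) \<and> hyperbolic (G Mod K i) (S i)"
      using S1 S2 S3 by cases (simp_all only: SK simp_thms)
  qed
  moreover have "K 1 \<inter> K 2 = {\<one>}" "K 2 \<inter> K 3 = {\<one>}" "K 1 \<inter> K 3 = {\<one>}"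
    unfolding SK using basis3_axes_disjoint[OF basis] basis3_axes_disjoint[OF basis']
      basis3_axes_disjoint[OF basis''] by (simp_all only: Int_commute)
  ultimately have "beauville_structure3 G S K"
    unfolding beauville_structure3_def using is_group fin by (intro conjI)
  then show ?thesis unfolding has_beauville_structure3_def by blast
qed

end

section \<open>The group \<open>\<int>\<^sub>n\<^sup>3\<close>\<close>

abbreviation integer_mod_cube :: "nat \<Rightarrow> (int \<times> int \<times> int) monoid" where
  "integer_mod_cube n \<equiv> integer_mod_group n \<times>\<times> integer_mod_group n \<times>\<times> integer_mod_group n"

lemma comm_group_integer_mod_cube: "comm_group (integer_mod_cube n)"
proof (rule group.group_comm_groupI)
  show "group (integer_mod_cube n)"
    by (intro DirProd_group group_integer_mod_group)
qed (auto simp: add.commute)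

lemma nat_pow_integer_mod_cube:
  "(x, y, z) [^]\<^bsub>integer_mod_cube n\<^esub> (k :: nat)
    = ((int k * x) mod int n, (int k * y) mod int n, (int k * z) mod int n)"
proof (induction k)
  case (Suc k)
  then show ?case by (simp add: mod_add_left_eq distrib_right) (simp add: add.commute)
qed simp

lemma int_pow_integer_mod_cube:
  assumes "n > 0" "(x, y, z) \<in> carrier (integer_mod_cube n)"
  shows "(x, y, z) [^]\<^bsub>integer_mod_cube n\<^esub> (k :: int)
    = ((k * x) mod int n, (k * y) mod int n, (k * z) mod int n)"
proof -
  interpret comm_group "integer_mod_cube n" by (rule comm_group_integer_mod_cube)
  have "(x, y, z) [^]\<^bsub>integer_mod_cube n\<^esub> n = \<one>\<^bsub>integer_mod_cube n\<^esub>"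
    by (simp add: nat_pow_integer_mod_cube)
  note reduce = int_pow_mod[OF assms(2) this, of k]
  define w where "w = nat (k mod int n)"
  have w: "k mod int n = int w" using assms(1) by (simp add: w_def)
  have "(k * a) mod int n = (int w * a) mod int n" for a
    unfolding w[symmetric] by (simp add: mod_mult_left_eq)
  then show ?thesis
    unfolding reduce w int_pow_int nat_pow_integer_mod_cube by (simp only:)
qed

text \<open>For \<open>n = 2m\<close> the element \<open>(m, 0, 0)\<close> is a nontrivial \<open>m\<close>-th power, and for \<open>n = 3m\<close> the origin and
  the three multiples \<open>m e\<^sub>i\<close> of the standard basis vectors are already four \<open>m\<close>-th powers.\<close>
lemma beauville_structure3_integer_mod_cubeD:
  assumes n: "n \<ge> 2" and B: "beauville_structure3 (integer_mod_cube n) S K"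
  shows "gcd n 6 = 1"
proof -
  interpret comm_group "integer_mod_cube n" by (rule comm_group_integer_mod_cube)
  let ?G = "integer_mod_cube n"
  have exp: "x [^]\<^bsub>?G\<^esub> n = \<one>\<^bsub>?G\<^esub>" for x
    by (cases x) (simp add: nat_pow_integer_mod_cube)
  have unit: "(1, 0, 0) \<in> carrier ?G" "(0, 1, 0) \<in> carrier ?G" "(0, 0, 1) \<in> carrier ?G" "(0, 0, 0) \<in> carrier ?G"
    using n by (auto simp: carrier_integer_mod_group)
  have "\<not> 2 dvd n"
  proof
    assume "2 dvd n"
    then obtain m where m: "n = 2 * m" by (rule dvdE)
    have "(1, 0, 0) [^]\<^bsub>?G\<^esub> m = \<one>\<^bsub>?G\<^esub>"
      using beauville_structure3_exponent_even[OF B _ unit(1)] exp m by blast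
    then show False using m n by (simp add: nat_pow_integer_mod_cube)
  qed
  moreover have "\<not> 3 dvd n"
  proof
    assume "3 dvd n"
    then obtain m where m: "n = 3 * m" by (rule dvdE)
    let ?V = "(\<lambda>x. x [^]\<^bsub>?G\<^esub> m) ` carrier ?G"
    have le: "card ?V \<le> 3"
      using beauville_structure3_exponent_triple[OF B] exp m by blast
    have "{(1, 0, 0), (0, 1, 0), (0, 0, 1), (0, 0, 0)} \<subseteq> carrier ?G"
      using unit by blast
    then have "(\<lambda>x. x [^]\<^bsub>?G\<^esub> m) ` {(1, 0, 0), (0, 1, 0), (0, 0, 1), (0, 0, 0)} \<subseteq> ?V"
      by (rule image_mono)
    then have "{(int m, 0, 0), (0, int m, 0), (0, 0, int m), (0, 0, 0)} \<subseteq> ?V"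
      using m by (simp add: nat_pow_integer_mod_cube)
    moreover have "finite ?V"
      using B by (intro finite_imageI) (simp add: beauville_structure3_def)
    moreover have "card {(int m, 0, 0), (0, int m, 0), (0, 0, int m), (0, 0, 0 :: int)} = 4"
      using m n by simp
    ultimately have "4 \<le> card ?V" by (metis card_mono)
    then show False using le by linarith
  qed
  moreover have "coprime n 2 \<longleftrightarrow> \<not> 2 dvd n" "coprime n 3 \<longleftrightarrow> \<not> 3 dvd n"
    using prime_imp_coprime[of 2 n] prime_imp_coprime[of 3 n] by (auto simp: coprime_commute)
  ultimately have "coprime n (2 * 3)" by (simp only: coprime_mult_right_iff not_False_eq_True simp_thms)
  then show ?thesis by (simp add: coprime_iff_gcd_eq_1)
qed

lemma ex_beauville_structure3_integer_mod_cube: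
  assumes n: "n \<ge> 2" and cop: "gcd n 6 = 1"
  shows "has_beauville_structure3 (integer_mod_cube n)"
proof -
  interpret comm_group "integer_mod_cube n" by (rule comm_group_integer_mod_cube)
  let ?G = "integer_mod_cube n"
  have "coprime n 6" using cop by (simp only: coprime_iff_gcd_eq_1)
  then have "\<not> 2 dvd n" "\<not> 3 dvd n"
    by (auto dest: coprime_common_divisor_nat[of n 6])
  then have n3: "n > 3" using n by presburger
  have "coprime (int n) (int 6)"
    using \<open>coprime n 6\<close> by (simp only: coprime_int_iff)
  then have "coprime (2 * 3) (int n)" by (simp add: coprime_commute)
  then have cop23: "coprime 2 (int n)" "coprime 3 (int n)" by (simp_all only: coprime_mult_left_iff)
  have carr: "carrier (integer_mod_group n) = {0..<int n}"
    using n by (simp add: carrier_integer_mod_group)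
  have unit: "(1, 0, 0) \<in> carrier ?G" "(0, 1, 0) \<in> carrier ?G" "(0, 0, 1) \<in> carrier ?G"
    using n by (auto simp: carr)
  have pow: "(1, 0, 0) [^]\<^bsub>?G\<^esub> u = (u mod int n, 0, 0)" "(0, 1, 0) [^]\<^bsub>?G\<^esub> u = (0, u mod int n, 0)"
    "(0, 0, 1) [^]\<^bsub>?G\<^esub> u = (0, 0, u mod int n)" for u :: int
    using n unit by (simp_all add: int_pow_integer_mod_cube)
  have comb: "(1, 0, 0) [^]\<^bsub>?G\<^esub> x \<otimes>\<^bsub>?G\<^esub> ((0, 1, 0) [^]\<^bsub>?G\<^esub> y \<otimes>\<^bsub>?G\<^esub> (0, 0, 1) [^]\<^bsub>?G\<^esub> z)
      = (x mod int n, y mod int n, z mod int n)" for x y z :: int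
    by (simp add: pow)
  have "\<exists>x y z. g = (x mod int n, y mod int n, z mod int n)" if g: "g \<in> carrier ?G" for g
  proof -
    obtain x y z where "g = (x, y, z)" by (cases g)
    then have "g = (x mod int n, y mod int n, z mod int n)" using g by (simp add: carr)
    then show ?thesis by blast
  qed
  then have "is_basis3 n (1, 0, 0) (0, 1, 0) (0, 0, 1)"
    unfolding is_basis3_def comb using unit by (auto simp: nat_pow_integer_mod_cube mod_eq_0_iff_dvd)
  moreover have "finite (carrier ?G)" by (simp add: carr)
  ultimately show ?thesis
    using n3 cop23 by (rule basis3_has_beauville_structure3)
qed

theorem proposition5p5:
  fixes n :: nat
  assumes "n \<ge> 2"
  shows "has_beauville_structure3
           (integer_mod_group n \<times>\<times> integer_mod_group n \<times>\<times> integer_mod_group n)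
         \<longleftrightarrow> gcd n 6 = 1"
  using beauville_structure3_integer_mod_cubeD[OF assms] ex_beauville_structure3_integer_mod_cube[OF assms]
  by (auto simp: has_beauville_structure3_def)

end
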